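(* Let $\sigma:\mathbb{R}\to\mathbb{R}$ be arbitrarily often differentiable on some open interval in $\mathbb{R}$ and let $\sigma$ be no polynomial on that interval. Let $r\in\mathbb{N}$. For each positive, monotonically decreasing sequence $(\alpha_n)_{n=1}^\infty$, $\alpha_n>0$, and each $0<\beta<1$ there exists $f_\beta\in C[0,1]$ such that (for $n\to\infty$) $$\omega_r\Big(f_\beta,\frac1n\Big)\le C\frac{1}{n^{r\beta}}\ \text{ with a constant } C \text{ independent of } n,\qquad \omega_r\Big(f_\beta,\frac1n\Big)\ne o\Big(\frac{1}{n^{r\beta}}\Big),$$ and $$\limsup_{n\to\infty}\frac{\omega_r\big(f_\beta,\frac1n\big)}{E(\Phi_{n,\sigma},f_\beta)}\,\alpha_n>0,\quad\text{i.e.,}\quad \omega_r\Big(f_\beta,\frac1n\Big)\ne o\Big(\frac{1}{\alpha_n}E(\Phi_{n,\sigma},f_\beta)\Big).$$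
   Context: $\mathbb{N}=\{1,2,\dots\}$. For $\sigma:\mathbb{R}\to\mathbb{R}$, $$\Phi_{n,\sigma}:=\Big\{g:[0,1]\to\mathbb{R}:\ g(x)=\sum_{k=1}^n a_k\sigma(b_kx+c_k),\ a_k,b_k,c_k\in\mathbb{R}\Big\}.$$ For $f\in C[0,1]$, $E(\Phi_{n,\sigma},f):=\inf\{\sup_{x\in[0,1]}|f(x)-g(x)|: g\in\Phi_{n,\sigma}\}$ (the supremum is $+\infty$ if $f-g$ is unbounded). If $E(\Phi_{n,\sigma},f_\beta)=0$, the quotient of a positive number by it is read as $+\infty$. The $r$th difference is $\Delta_h^rf(x):=\sum_{j=0}^r(-1)^{r-j}\binom rj f(x+jh)$ for $x\in[0,1-rh]$, and the $r$th uniform modulus of smoothness is $\omega_r(f,\delta):=\sup\{|\Delta_h^rf(x)|:x\in[0,1-rh],\ 0<h\le\delta\}$ (only step sizes with $rh\le1$ contribute). *)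

theory Defs
  imports
    "HOL-Analysis.Analysis"
    "HOL-Library.Landau_Symbols"
    "HOL-Computational_Algebra.Polynomial"
begin

text \<open>Functions on \<open>[0,1]\<close> are represented by functions on all of the reals of which only the
  values on \<open>{0..1}\<close> matter.\<close>

text \<open>For open \<open>S\<close> the iterates of \<^const>\<open>deriv\<close> at points of \<open>S\<close> depend only on the values of
  \<open>f\<close> on \<open>S\<close>, so this is differentiability of every order on \<open>S\<close>.\<close>

definition infinitely_differentiable_on :: "(real \<Rightarrow> real) \<Rightarrow> real set \<Rightarrow> bool" where
  "infinitely_differentiable_on f S \<longleftrightarrow> (\<forall>k. \<forall>x\<in>S. (deriv ^^ k) f differentiable (at x))"

definition polynomial_on :: "(real \<Rightarrow> real) \<Rightarrow> real set \<Rightarrow> bool" where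
  "polynomial_on f S \<longleftrightarrow> (\<exists>p :: real poly. \<forall>x\<in>S. f x = poly p x)"

definition Phi :: "nat \<Rightarrow> (real \<Rightarrow> real) \<Rightarrow> (real \<Rightarrow> real) set" where
  "Phi n \<sigma> = {g. \<exists>a b c :: nat \<Rightarrow> real. \<forall>x\<in>{0..1}. g x = (\<Sum>k=1..n. a k * \<sigma> (b k * x + c k))}"

text \<open>Extended real, since the inner supremum is infinite when \<open>f - g\<close> is unbounded on \<open>[0,1]\<close>.
  In \<^typ>\<open>ereal\<close>, a positive number divided by \<open>0\<close> is \<open>\<infinity>\<close>.\<close>

definition approx_error :: "(real \<Rightarrow> real) set \<Rightarrow> (real \<Rightarrow> real) \<Rightarrow> ereal" where
  "approx_error G f = (INF g\<in>G. SUP x\<in>{0..1}. ereal \<bar>f x - g x\<bar>)"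

definition difference :: "nat \<Rightarrow> real \<Rightarrow> (real \<Rightarrow> real) \<Rightarrow> real \<Rightarrow> real" where
  "difference r h f x = (\<Sum>j=0..r. (-1) ^ (r - j) * real (r choose j) * f (x + real j * h))"

text \<open>A supremum in \<^typ>\<open>real\<close>: for \<open>f\<close> continuous on \<open>[0,1]\<close> and \<open>\<delta> > 0\<close> the set is nonempty
  and bounded. Step sizes with \<open>r * h > 1\<close> contribute nothing, as then \<open>{0..1 - r * h}\<close> is empty.\<close>

definition modulus_of_smoothness :: "nat \<Rightarrow> (real \<Rightarrow> real) \<Rightarrow> real \<Rightarrow> real" where
  "modulus_of_smoothness r f \<delta> =
     Sup {\<bar>difference r h f x\<bar> | x h. 0 < h \<and> h \<le> \<delta> \<and> x \<in> {0..1 - real r * h}}"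

end

theory Submission
  imports Defs
begin

text \<open>The witness is an explicit lacunary power series: with \<open>s = r\<beta>\<close>,
  \<open>f x = (\<Sum>j. real (m j) powr (- s) * x ^ m j)\<close>,
  where the exponents \<open>m\<^sub>j\<close> grow as fast as needed.

  Monomials play the role that oscillating functions usually have in such constructions. By the
  mean value theorem for differences (\<open>difference_power_bounds\<close>),
  \<open>h\<^sup>r (m - r)\<^sup>r x\<^sup>m \<le> \<Delta> \<le> (h m)\<^sup>r\<close> for the \<open>r\<close>th difference \<open>\<Delta>\<close> of \<open>x\<^sup>m\<close> with step \<open>h\<close>
  at points where it only involves arguments in \<open>[0,1]\<close>. The upper bound, together with the trivial bound \<open>2\<^sup>r\<close>, gives the order \<open>n\<^sup>-\<^sup>s\<close> of the modulus of \<open>f\<close>: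
  terms with \<open>m\<^sub>j \<le> n\<close> are summed from the top as a geometric sum of \<open>m\<^sub>j\<close> to the power
  \<open>r - s\<close>, terms with \<open>m\<^sub>j > n\<close> as a geometric tail (\<open>modulus_of_smoothness_lacunary_le\<close>).
  The lower bound shows that all differences are nonnegative, so that nothing cancels in the series
  and the modulus of \<open>f\<close> is at least the contribution of any single term
  (\<open>term_le_modulus_of_smoothness\<close>). For step \<open>h = 1/m\<^sub>j\<close> at \<open>x = 1 - r/m\<^sub>j\<close> the \<open>j\<close>th
  term contributes at least about \<open>exp(-r)\<close> times \<open>m\<^sub>j\<close> to the power \<open>-s\<close>, hence the modulus is not
  of smaller order.

  For the approximation error, the point is that polynomials of degree at most \<open>M\<close> have error
  exactly \<open>0\<close> with a number of neurons depending only on \<open>M\<close>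
  (\<open>in_uniform_closure_poly\<close>): a \<open>k\<close>th divided difference of \<open>\<sigma>(b x + c)\<close> in \<open>b\<close> at \<open>0\<close> tends
  to \<open>x\<^sup>k\<close> times the \<open>k\<close>th derivative of \<open>\<sigma>\<close> at \<open>c\<close>, and this derivative is nonzero for a suitable \<open>c\<close>
  since \<open>\<sigma>\<close> is not a polynomial. So with \<open>n = (m\<^sub>j + 1)\<^sup>2\<close> neurons the error of \<open>f\<close> is at most the
  tail of the series after the \<open>j\<close>th term. The next exponent is chosen only after \<open>n\<close> is known,
  so this tail can be made smaller than \<open>\<alpha>\<^sub>n\<close> times the contribution of the first monomial to the
  modulus at \<open>1/n\<close>, a positive number that does not depend on the exponents still to be chosen.\<close>

section \<open>Higher differences\<close>

text \<open>Pascal's rule. This recursion is what allows induction on the order of the difference.\<close>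

lemma difference_Suc:
  "difference (Suc r) h f x = difference r h f (x + h) - difference r h f x"
proof -
  define T where "T j = f (x + real j * h)" for j
  have "difference r h f (x + h) = (\<Sum>j\<le>r. (-1) ^ (r - j) * real (r choose j) * T (Suc j))"
    by (simp add: difference_def T_def atLeast0AtMost algebra_simps)
  moreover have "difference r h f x
      = (-1) ^ r * T 0 - (\<Sum>j\<le>r. (-1) ^ (r - j) * real (r choose Suc j) * T (Suc j))"
  proof -
    have "difference r h f x = (\<Sum>j\<le>Suc r. (-1) ^ (r - j) * real (r choose j) * T j)"
      by (simp add: difference_def T_def atLeast0AtMost)
    also have "\<dots> = (-1) ^ r * T 0
        + (\<Sum>j\<le>r. (-1) ^ (r - Suc j) * real (r choose Suc j) * T (Suc j))"
      by (subst sum.atMost_Suc_shift) simp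
    also have "(\<Sum>j\<le>r. (-1) ^ (r - Suc j) * real (r choose Suc j) * T (Suc j))
        = (\<Sum>j\<le>r. - ((-1) ^ (r - j) * real (r choose Suc j) * T (Suc j)))"
    proof (rule sum.cong)
      fix j assume "j \<in> {..r}"
      show "(-1) ^ (r - Suc j) * real (r choose Suc j) * T (Suc j)
          = - ((-1) ^ (r - j) * real (r choose Suc j) * T (Suc j))"
      proof (cases "j < r")
        case True
        then have "r - j = Suc (r - Suc j)" by simp
        then show ?thesis by simp
      next
        case False
        with \<open>j \<in> {..r}\<close> show ?thesis by simp
      qed
    qed simp
    finally show ?thesis by (simp add: sum_negf)
  qed
  moreover have "difference (Suc r) h f x = (-1) ^ Suc r * T 0
      + (\<Sum>j\<le>r. (-1) ^ (r - j) * real (Suc r choose Suc j) * T (Suc j))"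
    by (simp add: difference_def T_def atLeast0AtMost sum.atMost_Suc_shift del: binomial_Suc_Suc sum.atMost_Suc)
  ultimately show ?thesis
    by (simp add: algebra_simps sum.distrib)
qed

lemma abs_difference_le:
  assumes "\<And>j. j \<le> r \<Longrightarrow> \<bar>f (x + real j * h)\<bar> \<le> M"
  shows "\<bar>difference r h f x\<bar> \<le> 2 ^ r * M"
proof -
  have "\<bar>difference r h f x\<bar> \<le> (\<Sum>j\<le>r. real (r choose j) * M)"
    unfolding difference_def atLeast0AtMost
    by (intro order.trans[OF sum_abs] sum_mono)
       (auto simp: abs_mult power_abs intro!: mult_left_mono assms)
  also have "\<dots> = real (\<Sum>j\<le>r. r choose j) * M"
    by (simp add: sum_distrib_right)
  also have "\<dots> = 2 ^ r * M"
    by (simp only: choose_row_sum) simp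
  finally show ?thesis .
qed

text \<open>Iterated mean value theorem: a difference commutes with differentiation in \<open>x\<close>, so the outermost
  difference of order \<open>k + 1\<close> turns into \<open>h\<close> times a difference of order \<open>k\<close> of the derivative.
  The sequence \<open>F\<close> stands for the successive derivatives of \<open>F 0\<close>. The step \<open>h = 0\<close> is included
  because the networks below are evaluated with step \<open>b * x\<close>, where \<open>x\<close> may be \<open>0\<close>.\<close>

lemma difference_mean_value:
  fixes F :: "nat \<Rightarrow> real \<Rightarrow> real"
  assumes "0 \<le> h"
    and "\<And>i t. i < k \<Longrightarrow> x \<le> t \<Longrightarrow> t \<le> x + real k * h
      \<Longrightarrow> (F i has_real_derivative F (Suc i) t) (at t)"
  shows "\<exists>\<xi>. x \<le> \<xi> \<and> \<xi> \<le> x + real k * h \<and> difference k h (F 0) x = h ^ k * F k \<xi>"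
  using assms(2)
proof (induction k arbitrary: F x)
  case 0
  then show ?case by (auto simp: difference_def)
next
  case (Suc k)
  have deriv: "((\<lambda>t. difference k h (F 0) t) has_real_derivative difference k h (F 1) t) (at t)"
    if "x \<le> t" "t \<le> x + h" for t
    unfolding difference_def
  proof (intro DERIV_sum DERIV_cmult)
    fix j assume "j \<in> {0..k}"
    then have "real j * h \<le> real k * h" "0 \<le> real j * h"
      using \<open>0 \<le> h\<close> by (auto intro: mult_right_mono)
    then have "x \<le> t + real j * h" "t + real j * h \<le> x + real (Suc k) * h"
      using that \<open>0 \<le> real j * h\<close> unfolding of_nat_Suc distrib_right by linarith+
    then have "(F 0 has_real_derivative F 1 (t + real j * h)) (at (t + real j * h))"
      using Suc.prems[of 0 "t + real j * h"] by simp
    then show "((\<lambda>t. F 0 (t + real j * h)) has_real_derivative F 1 (t + real j * h)) (at t)"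
      by (simp add: DERIV_shift)
  qed
  obtain z where z: "x \<le> z" "z \<le> x + h"
    "difference k h (F 0) (x + h) - difference k h (F 0) x = h * difference k h (F 1) z"
  proof (cases "h = 0")
    case True
    then show ?thesis using that[of x] by simp
  next
    case False
    then obtain z where "x < z" "z < x + h"
      "difference k h (F 0) (x + h) - difference k h (F 0) x = (x + h - x) * difference k h (F 1) z"
      using MVT2[of x "x + h" "\<lambda>t. difference k h (F 0) t" "\<lambda>t. difference k h (F 1) t"]
        deriv \<open>0 \<le> h\<close> by force
    then show ?thesis by (intro that[of z]) auto
  qed
  have "\<exists>\<xi>. z \<le> \<xi> \<and> \<xi> \<le> z + real k * h
      \<and> difference k h (F (Suc 0)) z = h ^ k * F (Suc k) \<xi>"
    by (rule Suc.IH[where F = "\<lambda>i. F (Suc i)"]) (use Suc.prems z(1,2) in \<open>auto simp: algebra_simps\<close>)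
  then obtain \<xi> where "z \<le> \<xi>" "\<xi> \<le> z + real k * h"
    "difference k h (F 1) z = h ^ k * F (Suc k) \<xi>" by auto
  then show ?case
    using z by (intro exI[of _ \<xi>]) (auto simp: difference_Suc algebra_simps)
qed

text \<open>The \<open>r\<close>th derivative of \<open>t ^ m\<close> is a falling factorial, between \<open>(m - r) ^ r\<close> and \<open>m ^ r\<close>, times
  \<open>t ^ (m - r)\<close>. The truncated subtraction makes both bounds correct for \<open>m < r\<close> as well.\<close>

lemma difference_power_bounds:
  assumes "0 \<le> h" "0 \<le> x" "x + real r * h \<le> 1"
  shows "h ^ r * real (m - r) ^ r * x ^ m \<le> difference r h (\<lambda>t. t ^ m) x"
    and "difference r h (\<lambda>t. t ^ m) x \<le> (h * real m) ^ r"
proof -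
  define F where "F i t = real (\<Prod>l<i. m - l) * t ^ (m - i)" for i and t :: real
  have deriv: "(F i has_real_derivative F (Suc i) t) (at t)" for i t
    unfolding F_def by (auto intro!: derivative_eq_intros)
  obtain \<xi> where \<xi>: "x \<le> \<xi>" "\<xi> \<le> x + real r * h"
    and eq: "difference r h (F 0) x = h ^ r * F r \<xi>"
    using difference_mean_value[of h r x F] deriv assms(1) by blast
  have F0: "F 0 = (\<lambda>t. t ^ m)" unfolding F_def by simp
  have \<xi>01: "0 \<le> \<xi>" "\<xi> \<le> 1" using \<xi> assms by auto
  have "(\<Prod>l<r. m - r) \<le> (\<Prod>l<r. m - l)" by (intro prod_mono) auto
  from of_nat_mono[OF this, where ?'a = real]
  have lo: "real (m - r) ^ r \<le> real (\<Prod>l<r. m - l)"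
    by (simp del: of_nat_prod)
  have "(\<Prod>l<r. m - l) \<le> (\<Prod>l<r. m)" by (intro prod_mono) auto
  from of_nat_mono[OF this, where ?'a = real]
  have hi: "real (\<Prod>l<r. m - l) \<le> real m ^ r"
    by (simp del: of_nat_prod)
  \<comment> \<open>Raising the exponent to \<open>m\<close> weakens the bound slightly but keeps it free of \<open>\<xi>\<close>.\<close>
  have "x ^ m \<le> \<xi> ^ m" using \<xi>(1) assms(2) by (rule power_mono)
  also have "\<dots> \<le> \<xi> ^ (m - r)" using \<xi>01 by (intro power_decreasing) auto
  finally have "real (m - r) ^ r * x ^ m \<le> F r \<xi>"
    unfolding F_def using lo assms(2) by (intro mult_mono) (auto intro: prod_nonneg)
  then show "h ^ r * real (m - r) ^ r * x ^ m \<le> difference r h (\<lambda>t. t ^ m) x"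
    using eq assms(1) by (simp add: F0 mult.assoc mult_left_mono)
  have "F r \<xi> \<le> real m ^ r * 1"
    unfolding F_def using hi \<xi>01 by (intro mult_mono) (auto intro: power_le_one)
  then show "difference r h (\<lambda>t. t ^ m) x \<le> (h * real m) ^ r"
    using eq assms(1) by (simp add: F0 power_mult_distrib mult_left_mono)
qed

section \<open>The modulus of smoothness\<close>

lemma modulus_of_smoothness_le:
  assumes "0 < \<delta>"
    and "\<And>x h. 0 < h \<Longrightarrow> h \<le> \<delta> \<Longrightarrow> 0 \<le> x \<Longrightarrow> x + real r * h \<le> 1 \<Longrightarrow> \<bar>difference r h f x\<bar> \<le> B"
  shows "modulus_of_smoothness r f \<delta> \<le> B"
  unfolding modulus_of_smoothness_def
proof (rule cSup_least)
  define h where "h = min \<delta> (1 / real (Suc r))"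
  have "real r * h \<le> real r * (1 / real (Suc r))"
    unfolding h_def by (intro mult_left_mono) auto
  also have "\<dots> \<le> 1" by simp
  finally have "0 < h \<and> h \<le> \<delta> \<and> (0::real) \<in> {0..1 - real r * h}"
    using assms(1) by (auto simp: h_def)
  then show "{\<bar>difference r h f x\<bar> |x h. 0 < h \<and> h \<le> \<delta> \<and> x \<in> {0..1 - real r * h}} \<noteq> {}"
    by blast
qed (use assms(2) in auto)

lemma difference_le_modulus_of_smoothness:
  assumes "\<And>x. x \<in> {0..1} \<Longrightarrow> \<bar>f x\<bar> \<le> M"
    and "0 < h" "h \<le> \<delta>" "0 \<le> x" "x + real r * h \<le> 1"
  shows "\<bar>difference r h f x\<bar> \<le> modulus_of_smoothness r f \<delta>"
  unfolding modulus_of_smoothness_def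
proof (rule cSup_upper)
  have "\<bar>difference r h f x\<bar> \<le> 2 ^ r * M" if "0 < h" "x \<in> {0..1 - real r * h}" for x h
  proof (rule abs_difference_le)
    fix j assume "j \<le> r"
    then have "real j * h \<le> real r * h" using \<open>0 < h\<close> by (intro mult_right_mono) auto
    moreover have "0 \<le> real j * h" using \<open>0 < h\<close> by simp
    ultimately have "x + real j * h \<in> {0..1}" using that(2) unfolding atLeastAtMost_iff by linarith
    then show "\<bar>f (x + real j * h)\<bar> \<le> M" by (rule assms(1))
  qed
  then show "bdd_above {\<bar>difference r h f x\<bar> |x h. 0 < h \<and> h \<le> \<delta> \<and> x \<in> {0..1 - real r * h}}"
    by (auto intro!: bdd_aboveI)
  show "\<bar>difference r h f x\<bar>
      \<in> {\<bar>difference r h f x\<bar> |x h. 0 < h \<and> h \<le> \<delta> \<and> x \<in> {0..1 - real r * h}}"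
    using assms(2-5) by force
qed

section \<open>Polynomials as limits of networks\<close>

text \<open>Equivalent to \<open>approx_error G p = 0\<close>, in a form that avoids extended reals.\<close>

definition in_uniform_closure :: "(real \<Rightarrow> real) set \<Rightarrow> (real \<Rightarrow> real) \<Rightarrow> bool" where
  "in_uniform_closure G p \<longleftrightarrow> (\<forall>e>0. \<exists>g\<in>G. \<forall>x\<in>{0..1}. \<bar>p x - g x\<bar> \<le> e)"

lemma Phi_neuron: "(\<lambda>x. a * \<sigma> (b * x + c)) \<in> Phi 1 \<sigma>"
  unfolding Phi_def mem_Collect_eq
  by (rule exI[of _ "\<lambda>_. a"], rule exI[of _ "\<lambda>_. b"], rule exI[of _ "\<lambda>_. c"]) simp

text \<open>Setting outer weights to zero makes neurons idle, which is why the classes \<^const>\<open>Phi\<close> increase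
  with the number of neurons.\<close>

lemma Phi_zero: "(\<lambda>x. 0) \<in> Phi n \<sigma>"
  unfolding Phi_def by (auto intro!: exI[of _ "\<lambda>_. 0"])

lemma Phi_scale:
  assumes "g \<in> Phi n \<sigma>"
  shows "(\<lambda>x. d * g x) \<in> Phi n \<sigma>"
proof -
  from assms obtain a b c where "\<forall>x\<in>{0..1}. g x = (\<Sum>k=1..n. a k * \<sigma> (b k * x + c k))"
    unfolding Phi_def by blast
  then have "\<forall>x\<in>{0..1}. d * g x = (\<Sum>k=1..n. (d * a k) * \<sigma> (b k * x + c k))"
    by (simp add: sum_distrib_left mult.assoc)
  then show ?thesis
    unfolding Phi_def mem_Collect_eq by (intro exI[where x = "\<lambda>k. d * a k"] exI[where x = b] exI[where x = c])
qed

lemma Phi_add: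
  assumes "g \<in> Phi m \<sigma>" "g' \<in> Phi n \<sigma>"
  shows "(\<lambda>x. g x + g' x) \<in> Phi (m + n) \<sigma>"
proof -
  from assms obtain a b c a' b' c' where
    g: "\<forall>x\<in>{0..1}. g x = (\<Sum>k=1..m. a k * \<sigma> (b k * x + c k))" and
    g': "\<forall>x\<in>{0..1}. g' x = (\<Sum>k=1..n. a' k * \<sigma> (b' k * x + c' k))"
    unfolding Phi_def by blast
  \<comment> \<open>Neurons \<open>1, \<dots>, m\<close> come from \<open>g\<close>, neurons \<open>m + 1, \<dots>, m + n\<close> from \<open>g'\<close>.\<close>
  define glue where "glue u v = (\<lambda>k. if k \<le> m then u k else v (k - m))" for u v :: "nat \<Rightarrow> real"
  have "g x + g' x = (\<Sum>k=1..m + n. glue a a' k * \<sigma> (glue b b' k * x + glue c c' k))"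
    if "x \<in> {0..1}" for x
  proof -
    have "(\<Sum>k=1..m + n. glue a a' k * \<sigma> (glue b b' k * x + glue c c' k))
        = (\<Sum>k=1..m. glue a a' k * \<sigma> (glue b b' k * x + glue c c' k))
        + (\<Sum>k=m + 1..m + n. glue a a' k * \<sigma> (glue b b' k * x + glue c c' k))"
      by (rule sum.ub_add_nat) simp
    also have "(\<Sum>k=m + 1..m + n. glue a a' k * \<sigma> (glue b b' k * x + glue c c' k))
        = (\<Sum>k=1..n. glue a a' (k + m) * \<sigma> (glue b b' (k + m) * x + glue c c' (k + m)))"
      using sum.shift_bounds_cl_nat_ivl
        [of "\<lambda>k. glue a a' k * \<sigma> (glue b b' k * x + glue c c' k)" 1 m n]
      by (simp add: add.commute)
    also have "\<dots> = g' x" using g' that by (auto simp: glue_def intro!: sum.cong)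
    also have "(\<Sum>k=1..m. glue a a' k * \<sigma> (glue b b' k * x + glue c c' k)) = g x"
      using g that by (auto simp: glue_def intro!: sum.cong)
    finally show ?thesis by simp
  qed
  then show ?thesis unfolding Phi_def by blast
qed

lemma Phi_sum:
  assumes "\<And>i. i < N \<Longrightarrow> g i \<in> Phi n \<sigma>"
  shows "(\<lambda>x. \<Sum>i<N. g i x) \<in> Phi (N * n) \<sigma>"
  using assms
proof (induction N)
  case 0
  then show ?case by (simp add: Phi_zero)
next
  case (Suc N)
  then have "(\<lambda>x. (\<Sum>i<N. g i x) + g N x) \<in> Phi (N * n + n) \<sigma>"
    by (intro Phi_add) auto
  then show ?case by (simp add: add.commute)
qed

lemma Phi_mono:
  assumes "m \<le> n"
  shows "Phi m \<sigma> \<subseteq> Phi n \<sigma>"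
proof
  fix g assume "g \<in> Phi m \<sigma>"
  from Phi_add[OF this Phi_zero[of "n - m"]] show "g \<in> Phi n \<sigma>" using assms by simp
qed

text \<open>If the \<open>k\<close>th derivative vanished on all of \<open>J\<close>, the remainder in Taylor's formula around any
  point of \<open>J\<close> would vanish, and \<open>\<sigma>\<close> would agree on \<open>J\<close> with its Taylor polynomial of degree less
  than \<open>k\<close>.\<close>

lemma nonpolynomial_imp_derivative_nonzero:
  assumes "is_interval J" "J \<noteq> {}" "infinitely_differentiable_on \<sigma> J" "\<not> polynomial_on \<sigma> J"
  shows "\<exists>c\<in>J. (deriv ^^ k) \<sigma> c \<noteq> 0"
proof (rule ccontr)
  assume "\<not> ?thesis"
  then have zero: "(deriv ^^ k) \<sigma> t = 0" if "t \<in> J" for t using that by blast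
  have deriv: "((deriv ^^ i) \<sigma> has_real_derivative (deriv ^^ Suc i) \<sigma> t) (at t)" if "t \<in> J" for i t
    using assms(3) that DERIV_deriv_iff_real_differentiable
    by (auto simp: infinitely_differentiable_on_def)
  have "k \<noteq> 0"
  proof
    assume "k = 0"
    then have "polynomial_on \<sigma> J"
      unfolding polynomial_on_def using zero by (intro exI[of _ 0]) simp
    with assms(4) show False ..
  qed
  obtain c where "c \<in> J" using assms(2) by blast
  define p where "p = (\<Sum>i<k. smult ((deriv ^^ i) \<sigma> c / fact i) ([:-c, 1:] ^ i))"
  have p: "poly p x = (\<Sum>i<k. (deriv ^^ i) \<sigma> c / fact i * (x - c) ^ i)" for x
    by (simp add: p_def poly_sum poly_power)
  have "\<sigma> x = poly p x" if "x \<in> J" for x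
  proof (cases "x = c")
    case True
    have "poly p c = (\<Sum>i<k. if i = 0 then \<sigma> c else 0)"
      unfolding p by (intro sum.cong) auto
    then show ?thesis using True \<open>k \<noteq> 0\<close> by simp
  next
    case False
    have sub: "{min x c..max x c} \<subseteq> J"
    proof
      fix t assume "t \<in> {min x c..max x c}"
      moreover have "min x c \<in> J" "max x c \<in> J"
        using \<open>x \<in> J\<close> \<open>c \<in> J\<close> by (auto simp: min_def max_def)
      ultimately show "t \<in> J"
        using mem_is_interval_1_I[OF assms(1), of "min x c" "max x c" t] unfolding atLeastAtMost_iff by blast
    qed
    have "\<exists>t. (if x < c then x < t \<and> t < c else c < t \<and> t < x) \<and>
      \<sigma> x = (\<Sum>i<k. (deriv ^^ i) \<sigma> c / fact i * (x - c) ^ i) + (deriv ^^ k) \<sigma> t / fact k * (x - c) ^ k"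
      by (rule Taylor[of k "\<lambda>i. (deriv ^^ i) \<sigma>" \<sigma> "min x c" "max x c" c x])
         (use \<open>k \<noteq> 0\<close> False deriv sub in auto)
    then obtain t where t: "if x < c then x < t \<and> t < c else c < t \<and> t < x"
      "\<sigma> x = (\<Sum>i<k. (deriv ^^ i) \<sigma> c / fact i * (x - c) ^ i) + (deriv ^^ k) \<sigma> t / fact k * (x - c) ^ k"
      by blast
    have "t \<in> J" using t(1) sub by (auto split: if_splits)
    then show ?thesis using t(2) zero p by simp
  qed
  then have "polynomial_on \<sigma> J" unfolding polynomial_on_def by blast
  with assms(4) show False ..
qed

text \<open>The function \<open>(b * x) ^ k\<close> times the \<open>k\<close>th derivative of \<open>\<sigma>\<close> at \<open>c\<close> is the leading term, as \<open>b\<close>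
  tends to \<open>0\<close>, of the \<open>k\<close>th difference of \<open>\<sigma>\<close> at \<open>c\<close> with step \<open>b * x\<close>. That difference
  is a network with \<open>k + 1\<close> neurons \<open>\<sigma> (j * b * x + c)\<close>.\<close>

lemma in_uniform_closure_power:
  assumes "open J" "is_interval J" "J \<noteq> {}" "infinitely_differentiable_on \<sigma> J"
    "\<not> polynomial_on \<sigma> J"
  shows "in_uniform_closure (Phi (Suc k) \<sigma>) (\<lambda>x. d * x ^ k)"
  unfolding in_uniform_closure_def
proof (intro allI impI)
  fix e :: real assume "e > 0"
  define D where "D i = (deriv ^^ i) \<sigma>" for i
  have deriv: "(D i has_real_derivative D (Suc i) t) (at t)" if "t \<in> J" for i t
    using assms(4) that DERIV_deriv_iff_real_differentiable
    by (auto simp: infinitely_differentiable_on_def D_def)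
  obtain c where c: "c \<in> J" "D k c \<noteq> 0"
    using nonpolynomial_imp_derivative_nonzero[OF assms(2-5)] unfolding D_def by blast
  \<comment> \<open>The tolerated variation of the \<open>k\<close>th derivative; the summand \<open>1\<close> covers \<open>d = 0\<close>.\<close>
  define \<epsilon> where "\<epsilon> = e * \<bar>D k c\<bar> / (\<bar>d\<bar> + 1)"
  have "\<epsilon> > 0" using \<open>e > 0\<close> c(2) by (simp add: \<epsilon>_def)
  have "isCont (D k) c" using deriv[OF c(1)] by (rule DERIV_isCont)
  then obtain \<eta> where \<eta>: "\<eta> > 0" "\<And>t. \<bar>t - c\<bar> < \<eta> \<Longrightarrow> \<bar>D k t - D k c\<bar> < \<epsilon>"
    using \<open>\<epsilon> > 0\<close> unfolding continuous_at_eps_delta dist_real_def by blast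
  obtain \<rho> where \<rho>: "\<rho> > 0" "\<And>t. \<bar>t - c\<bar> < \<rho> \<Longrightarrow> t \<in> J"
    using assms(1) c(1) unfolding open_dist dist_real_def by blast
  \<comment> \<open>So small that all points \<open>c + j * b * x\<close> stay in \<open>J\<close> and in the \<open>\<epsilon>\<close>-neighbourhood of continuity.\<close>
  define b where "b = min \<eta> \<rho> / (real k + 1)"
  have "b > 0" using \<eta>(1) \<rho>(1) by (simp add: b_def)
  moreover have "(real k + 1) * b = min \<eta> \<rho>" by (simp add: b_def)
  ultimately have b: "b > 0" "real k * b < min \<eta> \<rho>" by (auto simp: distrib_right)
  define g where "g x = d / (D k c * b ^ k) * difference k (b * x) \<sigma> c" for x
  have "(\<lambda>x. \<Sum>j<Suc k. (-1) ^ (k - j) * real (k choose j) * \<sigma> ((real j * b) * x + c))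
      \<in> Phi (Suc k * 1) \<sigma>"
    by (intro Phi_sum Phi_neuron)
  moreover have "(\<lambda>x. \<Sum>j<Suc k. (-1) ^ (k - j) * real (k choose j) * \<sigma> ((real j * b) * x + c))
      = (\<lambda>x. difference k (b * x) \<sigma> c)"
    by (simp only: difference_def atLeast0AtMost lessThan_Suc_atMost mult.assoc add.commute)
  ultimately have "g \<in> Phi (Suc k) \<sigma>"
    unfolding g_def by (simp only: Phi_scale mult_1_right)
  moreover have "\<bar>d * x ^ k - g x\<bar> \<le> e" if x: "x \<in> {0..1}" for x
  proof -
    have range: "\<bar>t - c\<bar> < min \<eta> \<rho>" if "c \<le> t" "t \<le> c + real k * (b * x)" for t
    proof -
      have "real k * b * x \<le> real k * b" using x b(1) by (intro mult_left_le) auto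
      then show ?thesis using that b(2) by (simp add: mult.assoc)
    qed
    obtain \<xi> where \<xi>: "c \<le> \<xi>" "\<xi> \<le> c + real k * (b * x)"
      "difference k (b * x) (D 0) c = (b * x) ^ k * D k \<xi>"
      using difference_mean_value[of "b * x" k c D] deriv range \<rho>(2) x b(1) by fastforce
    have "g x = d * x ^ k * (D k \<xi> / D k c)"
      using \<xi>(3) b(1) c(2) by (simp add: g_def D_def power_mult_distrib field_simps)
    then have "d * x ^ k - g x = d * x ^ k * ((D k c - D k \<xi>) / D k c)"
      using c(2) by (simp add: field_simps)
    then have "\<bar>d * x ^ k - g x\<bar> = \<bar>d\<bar> * x ^ k * (\<bar>D k \<xi> - D k c\<bar> / \<bar>D k c\<bar>)"
      using x by (simp add: abs_mult abs_divide power_abs abs_minus_commute)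
    also have "\<dots> \<le> (\<bar>d\<bar> + 1) * 1 * (\<epsilon> / \<bar>D k c\<bar>)"
      using x \<eta>(2)[of \<xi>] range[of \<xi>] \<xi>(1,2)
      by (intro mult_mono divide_right_mono) (auto intro: power_le_one less_imp_le)
    also have "\<dots> = e" using c(2) by (simp add: \<epsilon>_def add_nonneg_eq_0_iff)
    finally show ?thesis .
  qed
  ultimately show "\<exists>g\<in>Phi (Suc k) \<sigma>. \<forall>x\<in>{0..1}. \<bar>d * x ^ k - g x\<bar> \<le> e" by blast
qed

text \<open>The number \<open>(M + 1)\<^sup>2\<close> allows \<open>M + 1\<close> neurons for each of the \<open>M + 1\<close> monomials. What
  matters is that one number serves all polynomials of degree at most \<open>M\<close> and every accuracy.\<close>

lemma in_uniform_closure_poly: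
  assumes "open J" "is_interval J" "J \<noteq> {}" "infinitely_differentiable_on \<sigma> J"
    "\<not> polynomial_on \<sigma> J"
    and "degree p \<le> M"
  shows "in_uniform_closure (Phi ((Suc M)\<^sup>2) \<sigma>) (poly p)"
  unfolding in_uniform_closure_def
proof (intro allI impI)
  fix e :: real assume "e > 0"
  define \<epsilon> where "\<epsilon> = e / real (Suc M)"
  have "\<epsilon> > 0" using \<open>e > 0\<close> by (simp add: \<epsilon>_def)
  have "\<exists>g. g \<in> Phi (Suc M) \<sigma> \<and> (\<forall>x\<in>{0..1}. \<bar>coeff p i * x ^ i - g x\<bar> \<le> \<epsilon>)" if "i \<le> M" for i
  proof -
    obtain g where "g \<in> Phi (Suc i) \<sigma>" "\<forall>x\<in>{0..1}. \<bar>coeff p i * x ^ i - g x\<bar> \<le> \<epsilon>"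
      using in_uniform_closure_power[OF assms(1-5), of i "coeff p i"] \<open>\<epsilon> > 0\<close>
      unfolding in_uniform_closure_def by blast
    moreover have "Phi (Suc i) \<sigma> \<subseteq> Phi (Suc M) \<sigma>" using that by (intro Phi_mono) simp
    ultimately show ?thesis by blast
  qed
  then obtain g where g: "\<And>i. i \<le> M \<Longrightarrow> g i \<in> Phi (Suc M) \<sigma>"
    "\<And>i x. i \<le> M \<Longrightarrow> x \<in> {0..1} \<Longrightarrow> \<bar>coeff p i * x ^ i - g i x\<bar> \<le> \<epsilon>"
    by metis
  have "(\<lambda>x. \<Sum>i<Suc M. g i x) \<in> Phi ((Suc M)\<^sup>2) \<sigma>"
    unfolding power2_eq_square by (intro Phi_sum g(1)) simp
  moreover have "\<bar>poly p x - (\<Sum>i<Suc M. g i x)\<bar> \<le> e" if "x \<in> {0..1}" for x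
  proof -
    have "poly p x = (\<Sum>i<Suc M. coeff p i * x ^ i)"
      unfolding poly_altdef lessThan_Suc_atMost
      using assms(6) by (intro sum.mono_neutral_left) (auto simp: coeff_eq_0)
    then have "\<bar>poly p x - (\<Sum>i<Suc M. g i x)\<bar> = \<bar>\<Sum>i<Suc M. coeff p i * x ^ i - g i x\<bar>"
      by (simp only: sum_subtractf)
    also have "\<dots> \<le> (\<Sum>i<Suc M. \<epsilon>)"
      by (intro order.trans[OF sum_abs] sum_mono g(2) that) simp
    also have "\<dots> = e" by (simp add: \<epsilon>_def)
    finally show ?thesis .
  qed
  ultimately show "\<exists>g\<in>Phi ((Suc M)\<^sup>2) \<sigma>. \<forall>x\<in>{0..1}. \<bar>poly p x - g x\<bar> \<le> e"
    by (intro bexI[where x = "\<lambda>x. \<Sum>i<Suc M. g i x"] ballI)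
qed

lemma approx_error_le_distance_to_closure:
  assumes "in_uniform_closure G p" "\<And>x. x \<in> {0..1} \<Longrightarrow> \<bar>f x - p x\<bar> \<le> t"
  shows "approx_error G f \<le> ereal t"
proof (rule ereal_le_epsilon2)
  fix e :: real assume "e > 0"
  then obtain g where g: "g \<in> G" "\<And>x. x \<in> {0..1} \<Longrightarrow> \<bar>p x - g x\<bar> \<le> e"
    using assms(1) unfolding in_uniform_closure_def by blast
  have "(SUP x\<in>{0..1}. ereal \<bar>f x - g x\<bar>) \<le> ereal (t + e)"
  proof (rule SUP_least)
    fix x :: real assume "x \<in> {0..1}"
    then show "ereal \<bar>f x - g x\<bar> \<le> ereal (t + e)" using assms(2)[of x] g(2)[of x] by auto
  qed
  then have "(SUP x\<in>{0..1}. ereal \<bar>f x - g x\<bar>) \<le> ereal t + ereal e" by simp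
  with g(1) show "approx_error G f \<le> ereal t + ereal e"
    unfolding approx_error_def by (blast intro: order.trans[OF INF_lower])
qed

lemma approx_error_nonneg: "0 \<le> approx_error G f"
  unfolding approx_error_def
  by (intro INF_greatest order.trans[OF _ SUP_upper[of 0]]) auto

section \<open>Lacunary power series\<close>

lemma halving_summable:
  fixes v :: "nat \<Rightarrow> real"
  assumes "\<And>j. 0 \<le> v j" "\<And>j. v (Suc j) \<le> v j / 2"
  shows "summable v" and "(\<Sum>i. v (i + k)) \<le> 2 * v k"
proof -
  have geo: "v (i + k) \<le> v k * (1 / 2) ^ i" for i k
  proof (induction i)
    case (Suc i)
    then show ?case using assms(2)[of "i + k"] by simp
  qed simp
  have geo_sums: "(\<lambda>i. v k * (1 / 2) ^ i) sums (v k * 2)" for k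
    using sums_mult[OF geometric_sums[of "1 / 2 :: real"], of "v k"] by simp
  have shifted: "summable (\<lambda>i. v (i + k))" for k
  proof (rule summable_comparison_test'[OF sums_summable[OF geo_sums[of k]], of 0])
    fix i show "norm (v (i + k)) \<le> v k * (1 / 2) ^ i" using geo assms(1) by simp
  qed
  from shifted[of 0] show "summable v" by simp
  have "(\<Sum>i. v (i + k)) \<le> (\<Sum>i. v k * (1 / 2) ^ i)"
    using geo shifted sums_summable[OF geo_sums[of k]] by (rule suminf_le)
  also have "\<dots> = 2 * v k" using sums_unique[OF geo_sums[of k]] by simp
  finally show "(\<Sum>i. v (i + k)) \<le> 2 * v k" .
qed

text \<open>When the terms at least double at each step, the last one is at least half of the sum.\<close>

lemma doubling_sum_le:
  fixes u :: "nat \<Rightarrow> real"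
  assumes "\<And>j. 2 * u j \<le> u (Suc j)" "0 \<le> u 0" "0 \<le> B" "\<And>j. j < K \<Longrightarrow> u j \<le> B"
  shows "(\<Sum>j<K. u j) \<le> 2 * B"
proof (cases K)
  case 0
  then show ?thesis using assms(3) by simp
next
  case (Suc L)
  have "(\<Sum>j<Suc i. u j) \<le> 2 * u i" for i
  proof (induction i)
    case (Suc i)
    then show ?case using assms(1)[of i] by simp
  qed (use assms(2) in simp)
  from this[of L] show ?thesis using assms(4)[of L] Suc by simp
qed

text \<open>Nonnegative coefficients are essential: they prevent cancellation between the differences of
  the terms. Since \<open>\<bar>x\<bar> \<le> 1\<close>, summability of the coefficients controls the whole series uniformly.\<close>

locale nonneg_power_series =
  fixes a :: "nat \<Rightarrow> real" and m :: "nat \<Rightarrow> nat"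
  assumes nonneg: "\<And>j. 0 \<le> a j" and summable_a: "summable a"
begin

definition S :: "real \<Rightarrow> real" where
  "S x = (\<Sum>j. a j * x ^ m j)"

lemma term_bounds:
  assumes "x \<in> {0..1}"
  shows "0 \<le> a j * x ^ m j" "a j * x ^ m j \<le> a j"
  using assms nonneg[of j] by (auto intro: mult_left_le power_le_one)

lemma summable_terms:
  assumes "x \<in> {0..1}"
  shows "summable (\<lambda>j. a j * x ^ m j)"
  using summable_a by (rule summable_comparison_test'[of _ 0]) (use term_bounds[OF assms] in auto)

lemma abs_S_le:
  assumes "x \<in> {0..1}"
  shows "\<bar>S x\<bar> \<le> suminf a"
proof -
  have "0 \<le> S x" unfolding S_def
    by (intro suminf_nonneg summable_terms assms term_bounds)
  moreover have "S x \<le> suminf a" unfolding S_def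
    by (intro suminf_le summable_terms assms term_bounds summable_a)
  ultimately show ?thesis by simp
qed

lemma continuous_on_S: "continuous_on {0..1} S"
proof -
  have "uniform_limit {0..1} (\<lambda>n x. \<Sum>j<n. a j * x ^ m j) (\<lambda>x. \<Sum>j. a j * x ^ m j) sequentially"
    by (rule Weierstrass_m_test[OF _ summable_a]) (use term_bounds in auto)
  moreover have "\<forall>\<^sub>F n in sequentially. continuous_on {0..1} (\<lambda>x::real. \<Sum>j<n. a j * x ^ m j)"
    by (intro always_eventually allI continuous_intros)
  ultimately have "continuous_on {0..1} (\<lambda>x. \<Sum>j. a j * x ^ m j)"
    by (intro uniform_limit_theorem[OF _ _ trivial_limit_sequentially])
  then show ?thesis by (simp add: S_def[abs_def])
qed

lemma abs_S_minus_partial_sum_le: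
  assumes "x \<in> {0..1}"
  shows "\<bar>S x - (\<Sum>j<k. a j * x ^ m j)\<bar> \<le> (\<Sum>i. a (i + k))"
proof -
  have "S x - (\<Sum>j<k. a j * x ^ m j) = (\<Sum>i. a (i + k) * x ^ m (i + k))"
    unfolding S_def using suminf_split_initial_segment[OF summable_terms[OF assms], of k] by simp
  moreover have "0 \<le> (\<Sum>i. a (i + k) * x ^ m (i + k))"
    by (intro suminf_nonneg summable_ignore_initial_segment[OF summable_terms] assms term_bounds)
  moreover have "(\<Sum>i. a (i + k) * x ^ m (i + k)) \<le> (\<Sum>i. a (i + k))"
    by (intro suminf_le term_bounds assms summable_ignore_initial_segment summable_a
        summable_ignore_initial_segment[OF summable_terms])
  ultimately show ?thesis by simp
qed

lemma difference_S:
  assumes "0 < h" "0 \<le> x" "x + real r * h \<le> 1"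
  shows "(\<lambda>j. a j * difference r h (\<lambda>t. t ^ m j) x) sums difference r h S x"
proof -
  have in01: "x + real i * h \<in> {0..1}" if "i \<in> {0..r}" for i
  proof -
    have "0 \<le> real i * h" "real i * h \<le> real r * h"
      using that assms(1) by (auto intro: mult_right_mono)
    then show ?thesis using assms(2,3) unfolding atLeastAtMost_iff by linarith
  qed
  have "(\<lambda>j. \<Sum>i=0..r. (-1) ^ (r - i) * real (r choose i) * (a j * (x + real i * h) ^ m j))
      sums difference r h S x"
    unfolding difference_def S_def
    by (intro sums_sum sums_mult summable_sums summable_terms in01)
  then show ?thesis
    by (simp add: difference_def sum_distrib_left mult.left_commute)
qed

text \<open>The differences of all monomials are nonnegative, so the difference of the series is at least that
  of any one of its terms.\<close>

lemma term_le_modulus_of_smoothness: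
  assumes "0 < h" "h \<le> \<delta>" "0 \<le> x" "x + real r * h \<le> 1"
  shows "a j * (h ^ r * real (m j - r) ^ r * x ^ m j) \<le> modulus_of_smoothness r S \<delta>"
proof -
  have nn: "0 \<le> a i * difference r h (\<lambda>t. t ^ m i) x" for i
  proof -
    have "0 \<le> h ^ r * real (m i - r) ^ r * x ^ m i" using assms by simp
    also have "\<dots> \<le> difference r h (\<lambda>t. t ^ m i) x"
      using assms by (intro difference_power_bounds) auto
    finally show ?thesis using nonneg by simp
  qed
  have "a j * (h ^ r * real (m j - r) ^ r * x ^ m j) \<le> a j * difference r h (\<lambda>t. t ^ m j) x"
    using assms by (intro mult_left_mono difference_power_bounds nonneg) auto
  also have "\<dots> = (\<Sum>i\<in>{j}. a i * difference r h (\<lambda>t. t ^ m i) x)" by simp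
  also have "\<dots> \<le> difference r h S x"
    unfolding sums_unique[OF difference_S[OF assms(1,3,4)]]
    by (intro sum_le_suminf sums_summable[OF difference_S[OF assms(1,3,4)]] nn) simp_all
  also have "\<dots> \<le> \<bar>difference r h S x\<bar>" by simp
  also have "\<dots> \<le> modulus_of_smoothness r S \<delta>"
    using abs_S_le assms by (rule difference_le_modulus_of_smoothness)
  finally show ?thesis .
qed

text \<open>The partial sum with \<open>k\<close> terms is a polynomial and costs nothing; what remains is the tail.\<close>

lemma approx_error_S_le:
  assumes "open J" "is_interval J" "J \<noteq> {}" "infinitely_differentiable_on \<sigma> J"
    "\<not> polynomial_on \<sigma> J"
    and "\<And>j. j < k \<Longrightarrow> m j \<le> M"
  shows "approx_error (Phi ((Suc M)\<^sup>2) \<sigma>) S \<le> ereal (\<Sum>i. a (i + k))"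
proof (rule approx_error_le_distance_to_closure)
  define p where "p = (\<Sum>j<k. monom (a j) (m j))"
  have "degree p \<le> M"
    unfolding p_def using assms(6) by (intro degree_sum_le) (auto intro: order.trans[OF degree_monom_le])
  then show "in_uniform_closure (Phi ((Suc M)\<^sup>2) \<sigma>) (poly p)"
    using assms(1-5) by (intro in_uniform_closure_poly)
  fix x :: real assume "x \<in> {0..1}"
  then show "\<bar>S x - poly p x\<bar> \<le> (\<Sum>i. a (i + k))"
    using abs_S_minus_partial_sum_le by (simp add: p_def poly_sum poly_monom)
qed

end

lemma powr_power_eq:
  assumes "s + t = real r" "0 < x"
  shows "x powr (- s) * x ^ r = x powr t"
proof -
  have "x powr (- s) * x ^ r = x powr (- s + real r)"
    using assms(2) by (simp only: powr_add powr_realpow)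
  moreover have "- s + real r = t" using assms(1) by simp
  ultimately show ?thesis by simp
qed

text \<open>For steps up to \<open>1 / n\<close>, the difference of the \<open>j\<close>th monomial is at most \<open>(m j / n) ^ r\<close> and at most \<open>2 ^ r\<close>. The first bound is
  used while \<open>m j \<le> n\<close>, the second afterwards. In both ranges the term at the transition
  \<open>m j \<approx> n\<close> dominates, and it has size \<open>n powr (- s)\<close>.\<close>

lemma modulus_of_smoothness_lacunary_le:
  fixes m :: "nat \<Rightarrow> nat"
  assumes "strict_mono m" "0 < m 0" "0 < s" "0 < t" "s + t = real r"
    and halving: "\<And>j. real (m (Suc j)) powr (- s) \<le> real (m j) powr (- s) / 2"
    and doubling: "\<And>j. 2 * real (m j) powr t \<le> real (m (Suc j)) powr t"
    and "n \<ge> 1"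
  shows "modulus_of_smoothness r
      (nonneg_power_series.S (\<lambda>j. real (m j) powr (- s)) m) (1 / real n)
    \<le> (2 + 2 * 2 ^ r) * real n powr (- s)"
proof (rule modulus_of_smoothness_le)
  define a where "a j = real (m j) powr (- s)" for j
  have summable_a: "summable a" and tail: "(\<Sum>i. a (i + k)) \<le> 2 * a k" for k
    unfolding a_def by (auto intro!: halving_summable halving)
  interpret nonneg_power_series a m
    by unfold_locales (use summable_a in \<open>auto simp: a_def\<close>)
  fix x h :: real
  assume h: "0 < h" "h \<le> 1 / real n" and x: "0 \<le> x" "x + real r * h \<le> 1"
  define d where "d j = \<bar>difference r h (\<lambda>t. t ^ m j) x\<bar>" for j
  have m_pos: "0 < m j" for j
    using assms(1,2) by (metis gr0I le0 not_less strict_mono_less_eq)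
  have d_le_2: "d j \<le> 2 ^ r" for j
  proof -
    have "d j \<le> 2 ^ r * 1" unfolding d_def
    proof (rule abs_difference_le)
      fix i assume "i \<le> r"
      then have "0 \<le> real i * h" "real i * h \<le> real r * h"
        using h by (auto intro: mult_right_mono)
      then have "0 \<le> x + real i * h" "x + real i * h \<le> 1" using x by linarith+
      then show "\<bar>(x + real i * h) ^ m j\<bar> \<le> 1" by (simp add: power_le_one)
    qed
    then show ?thesis by simp
  qed
  have d_le_m: "d j \<le> (real (m j) / real n) ^ r" for j
  proof -
    have "0 \<le> h ^ r * real (m j - r) ^ r * x ^ m j" using h x by simp
    also have "\<dots> \<le> difference r h (\<lambda>t. t ^ m j) x"
      using h x by (intro difference_power_bounds) auto
    finally have "d j = difference r h (\<lambda>t. t ^ m j) x" by (simp add: d_def)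
    also have "\<dots> \<le> (h * real (m j)) ^ r"
      using h x by (intro difference_power_bounds) auto
    also have "\<dots> \<le> (1 / real n * real (m j)) ^ r"
      using h by (intro power_mono mult_right_mono) auto
    finally show ?thesis by simp
  qed
  have d_nonneg: "0 \<le> d j" for j by (simp add: d_def)
  have summable_ad: "summable (\<lambda>j. a j * d j)"
    using summable_mult2[OF summable_a, of "2 ^ r"]
    by (rule summable_comparison_test'[of _ 0])
       (use d_le_2 d_nonneg nonneg in \<open>auto simp: abs_mult intro: mult_left_mono\<close>)
  define K where "K = (LEAST j. n < m j)"
  have "\<exists>j. n < m j" using strict_mono_imp_increasing[OF assms(1), of "Suc n"] by (metis Suc_le_eq)
  then have "n < m K" unfolding K_def by (rule LeastI_ex)
  have below_K: "m j \<le> n" if "j < K" for j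
    using not_less_Least[of j "\<lambda>j. n < m j"] that unfolding K_def by simp

  have "(\<Sum>j<K. a j * d j) \<le> (\<Sum>j<K. real (m j) powr t / real n ^ r)"
  proof (rule sum_mono)
    fix j
    have "a j * d j \<le> a j * (real (m j) / real n) ^ r"
      by (intro mult_left_mono d_le_m nonneg)
    also have "\<dots> = real (m j) powr t / real n ^ r"
      using powr_power_eq[OF assms(5), of "real (m j)"] m_pos by (simp add: a_def power_divide)
    finally show "a j * d j \<le> real (m j) powr t / real n ^ r" .
  qed
  also have "\<dots> = (\<Sum>j<K. real (m j) powr t) / real n ^ r"
    by (simp add: sum_divide_distrib)
  also have "\<dots> \<le> 2 * real n powr t / real n ^ r"
    using below_K \<open>0 < t\<close>
    by (intro divide_right_mono doubling_sum_le doubling powr_mono2) auto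
  also have "\<dots> = 2 * real n powr (- s)"
    using powr_power_eq[OF assms(5), of "real n"] \<open>n \<ge> 1\<close> by (simp add: field_simps)
  finally have head_le: "(\<Sum>j<K. a j * d j) \<le> 2 * real n powr (- s)" .

  have "(\<Sum>i. a (i + K) * d (i + K)) \<le> (\<Sum>i. a (i + K) * 2 ^ r)"
    by (intro suminf_le mult_left_mono d_le_2 nonneg summable_mult2
        summable_ignore_initial_segment[OF summable_ad]
        summable_ignore_initial_segment[OF summable_a])
  also have "\<dots> = (\<Sum>i. a (i + K)) * 2 ^ r"
    by (rule suminf_mult2[symmetric]) (rule summable_ignore_initial_segment[OF summable_a])
  also have "\<dots> \<le> 2 * a K * 2 ^ r" by (intro mult_right_mono tail) simp
  also have "\<dots> \<le> 2 * real n powr (- s) * 2 ^ r"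
    unfolding a_def using \<open>n < m K\<close> \<open>n \<ge> 1\<close> \<open>0 < s\<close>
    by (intro mult_right_mono mult_left_mono powr_mono2') auto
  finally have tail_le: "(\<Sum>i. a (i + K) * d (i + K)) \<le> 2 * real n powr (- s) * 2 ^ r" .

  have sums: "(\<lambda>j. a j * difference r h (\<lambda>t. t ^ m j) x) sums difference r h S x"
    using difference_S h x by blast
  have "difference r h S x = (\<Sum>j. a j * difference r h (\<lambda>t. t ^ m j) x)"
    using sums by (rule sums_unique)
  also have "\<bar>\<dots>\<bar> \<le> (\<Sum>j. \<bar>a j * difference r h (\<lambda>t. t ^ m j) x\<bar>)"
    using summable_ad by (intro summable_rabs) (simp add: abs_mult d_def nonneg)
  also have "\<dots> = (\<Sum>j. a j * d j)" by (simp add: abs_mult d_def nonneg)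
  also have "\<dots> = (\<Sum>i. a (i + K) * d (i + K)) + (\<Sum>j<K. a j * d j)"
    using summable_ad by (rule suminf_split_initial_segment)
  also have "\<dots> \<le> (2 + 2 * 2 ^ r) * real n powr (- s)"
    using head_le tail_le by (simp add: algebra_simps)
  finally show "\<bar>difference r h (nonneg_power_series.S (\<lambda>j. real (m j) powr (- s)) m) x\<bar>
      \<le> (2 + 2 * 2 ^ r) * real n powr (- s)"
    by (simp add: a_def[abs_def])
qed (use assms in simp)

text \<open>The three growth conditions only ask the next exponent to be large in terms of the present one.
  The first two make the series and the sums in the upper estimate geometric. The last one lets
  the next coefficient be small compared with an arbitrary quantity \<open>\<epsilon>\<close> determined by the present
  exponent.\<close>

lemma exists_lacunary_exponents:
  fixes \<epsilon> :: "nat \<Rightarrow> real"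
  assumes "0 < s" "0 < t" "0 < m0" "\<And>M. m0 \<le> M \<Longrightarrow> 0 < \<epsilon> M"
  obtains m :: "nat \<Rightarrow> nat" where "strict_mono m" "m 0 = m0"
    "\<And>j. real (m (Suc j)) powr (- s) \<le> real (m j) powr (- s) / 2"
    "\<And>j. 2 * real (m j) powr t \<le> real (m (Suc j)) powr t"
    "\<And>j. real (m (Suc j)) powr (- s) \<le> \<epsilon> (m j)"
proof -
  define Q where "Q M N \<longleftrightarrow> M < N \<and> real N powr (- s) \<le> real M powr (- s) / 2 \<and>
      2 * real M powr t \<le> real N powr t \<and> real N powr (- s) \<le> \<epsilon> M" for M N :: nat
  have step: "\<exists>N. m0 \<le> N \<and> Q M N" if "m0 \<le> M" for M
  proof -
    have "0 < M" using that assms(3) by simp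
    have small: "\<forall>\<^sub>F N in sequentially. real N powr (- u) < c" if "0 < u" "0 < c" for u c
    proof (rule order_tendstoD(2)[OF _ \<open>0 < c\<close>])
      show "(\<lambda>N. real N powr (- u)) \<longlonglongrightarrow> 0"
        using that by (intro tendsto_neg_powr filterlim_real_sequentially) simp
    qed
    have "\<forall>\<^sub>F N in sequentially. M < N \<and> real N powr (- s) < real M powr (- s) / 2
        \<and> real N powr (- t) < real M powr (- t) / 2 \<and> real N powr (- s) < \<epsilon> M"
      using assms \<open>0 < M\<close> that by (intro eventually_conj small eventually_gt_at_top) auto
    then obtain N where N: "M < N" "real N powr (- s) < real M powr (- s) / 2"
      "real N powr (- t) < real M powr (- t) / 2" "real N powr (- s) < \<epsilon> M"
      using eventually_happens'[OF sequentially_bot] by blast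
    have "2 * real M powr t \<le> real N powr t"
      using N(1,3) \<open>0 < M\<close> by (simp add: powr_minus field_simps)
    then show ?thesis using N that unfolding Q_def by (intro exI[of _ N]) simp
  qed
  have "\<exists>m. \<forall>j. (m0 \<le> m j \<and> (j = 0 \<longrightarrow> m j = m0)) \<and> Q (m j) (m (Suc j))"
    by (rule dependent_nat_choice) (use step in auto)
  then obtain m where "m 0 = m0" "\<And>j. Q (m j) (m (Suc j))" by blast
  then show thesis
    by (intro that[of m]) (auto simp: Q_def strict_mono_Suc_iff)
qed

section \<open>Sharpness\<close>

text \<open>When \<open>E = 0\<close> the quotient is infinite and the bound still holds.\<close>

lemma one_le_ereal_ratio:
  fixes \<omega> \<alpha> :: real
  assumes "0 < \<omega>" "0 < \<alpha>" "0 \<le> E" "E \<le> ereal (\<alpha> * \<omega>)"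
  shows "1 \<le> ereal \<omega> / E * ereal \<alpha>"
proof -
  from assms obtain e where E: "E = ereal e" by (cases E) auto
  show ?thesis
  proof (cases "e = 0")
    case True
    then show ?thesis using assms(1,2) E by (simp add: divide_ereal_def)
  next
    case False
    then have "0 < e" "e \<le> \<alpha> * \<omega>" using assms(3,4) E by auto
    then show ?thesis using E by (simp add: field_simps one_ereal_def)
  qed
qed

theorem lemma2p1:
  fixes \<sigma> :: "real \<Rightarrow> real" and J :: "real set" and r :: nat
    and \<alpha> :: "nat \<Rightarrow> real" and \<beta> :: real
  assumes "open J" and "is_interval J" and "J \<noteq> {}"
    and "infinitely_differentiable_on \<sigma> J"
    and "\<not> polynomial_on \<sigma> J"
    and "r \<ge> 1"
    and "\<forall>n\<ge>1. \<alpha> n > 0" and "antimono_on {1..} \<alpha>"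
    and "0 < \<beta>" and "\<beta> < 1"
  shows "\<exists>f :: real \<Rightarrow> real. continuous_on {0..1} f
    \<and> (\<exists>C. \<forall>n::nat\<ge>1. modulus_of_smoothness r f (1 / real n) \<le> C * (1 / real n powr (real r * \<beta>)))
    \<and> (\<lambda>n::nat. modulus_of_smoothness r f (1 / real n)) \<notin> o(\<lambda>n. 1 / real n powr (real r * \<beta>))
    \<and> limsup (\<lambda>n::nat. ereal (modulus_of_smoothness r f (1 / real n))
          / approx_error (Phi n \<sigma>) f * ereal (\<alpha> n)) > 0
    \<and> (\<lambda>n::nat. modulus_of_smoothness r f (1 / real n))
        \<notin> o(\<lambda>n. 1 / \<alpha> n * real_of_ereal (approx_error (Phi n \<sigma>) f))"
proof -
  define s t where "s = real r * \<beta>" and "t = real r * (1 - \<beta>)"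
  have st: "0 < s" "0 < t" "s + t = real r"
    using assms(6,9,10) by (auto simp: s_def t_def algebra_simps)
  \<comment> \<open>The contribution of the first monomial, with exponent \<open>r + 1\<close>, to the modulus at \<open>1 / n\<close>. It
    does not depend on the later exponents, so it may enter their construction.\<close>
  define w where "w n = real (Suc r) powr (- s)
      * ((1 / real n) ^ r * real (Suc r - r) ^ r * (1 - real r / real n) ^ Suc r)" for n :: nat
  have w_pos: "0 < w n" if "r < n" for n using that by (simp add: w_def)
  \<comment> \<open>Halved because a tail of the series can be twice as large as its first coefficient.\<close>
  define \<epsilon> where "\<epsilon> M = \<alpha> ((Suc M)\<^sup>2) * w ((Suc M)\<^sup>2) / 2" for M
  have square_ge: "M < (Suc M)\<^sup>2" for M by (simp add: power2_eq_square)
  have "0 < \<epsilon> M" if "Suc r \<le> M" for M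
    using that assms(7) w_pos[of "(Suc M)\<^sup>2"] square_ge[of M] by (simp add: \<epsilon>_def)
  with st(1,2) obtain m where m: "strict_mono m" "m 0 = Suc r"
    and halving: "\<And>j. real (m (Suc j)) powr (- s) \<le> real (m j) powr (- s) / 2"
    and doubling: "\<And>j. 2 * real (m j) powr t \<le> real (m (Suc j)) powr t"
    and below_\<epsilon>: "\<And>j. real (m (Suc j)) powr (- s) \<le> \<epsilon> (m j)"
    using exists_lacunary_exponents[of s t "Suc r" \<epsilon>] by (metis zero_less_Suc)
  have m_gt: "r < m j" for j
    using m(2) strict_mono_less_eq[OF m(1), of 0 j] by simp
  define a where "a j = real (m j) powr (- s)" for j
  have summable_a: "summable a" and tail: "(\<Sum>i. a (i + k)) \<le> 2 * a k" for k
    unfolding a_def by (auto intro!: halving_summable halving)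
  interpret nonneg_power_series a m
    by unfold_locales (use summable_a in \<open>auto simp: a_def\<close>)
  define \<omega> where "\<omega> n = modulus_of_smoothness r S (1 / real n)" for n :: nat
  have \<omega>_ge: "a j * ((1 / real n) ^ r * real (m j - r) ^ r * (1 - real r / real n) ^ m j) \<le> \<omega> n"
    if "r < n" for j n
    unfolding \<omega>_def using that by (intro term_le_modulus_of_smoothness) auto

  have upper: "\<omega> n \<le> (2 + 2 * 2 ^ r) * (1 / real n powr s)" if "n \<ge> 1" for n
    using modulus_of_smoothness_lacunary_le[OF m(1) _ st halving doubling that] m(2)
    by (simp add: \<omega>_def a_def[abs_def] powr_minus_divide)

  have not_small: "\<omega> \<notin> o(\<lambda>n. 1 / real n powr s)"
  proof
    assume "\<omega> \<in> o(\<lambda>n. 1 / real n powr s)"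
    \<comment> \<open>A lower bound for the ratio of the \<open>j\<close>th contribution to \<open>a j\<close>, taken at \<open>h = 1 / M\<close>, \<open>x = 1 - r / M\<close> with
      \<open>M = m j\<close>: a difference of order \<open>r\<close> contributes \<open>((M - r) / M) ^ r\<close>, the monomial \<open>x ^ M\<close>.\<close>
    define q where "q M = (1 - real r / real M) ^ r * (1 - real r / real M) ^ M" for M :: nat
    have "(\<lambda>M. 1 - real r / real M) \<longlonglongrightarrow> 1 - 0"
      by (intro tendsto_diff tendsto_const lim_const_over_n)
    moreover have "(\<lambda>M. (1 - real r / real M) ^ M) \<longlonglongrightarrow> exp (- real r)"
      using tendsto_exp_limit_sequentially[of "- real r"] by simp
    ultimately have "q \<longlonglongrightarrow> (1 - 0) ^ r * exp (- real r)"
      unfolding q_def by (intro tendsto_mult tendsto_power)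
    then have "\<forall>\<^sub>F M in sequentially. exp (- real r) / 2 < q M"
      by (rule order_tendstoD(1)) simp
    moreover have "\<forall>\<^sub>F n in sequentially. norm (\<omega> n) \<le> exp (- real r) / 2 * norm (1 / real n powr s)"
      using \<open>\<omega> \<in> _\<close> by (rule landau_o.smallD) simp
    ultimately have "\<forall>\<^sub>F n in sequentially. \<omega> n \<le> exp (- real r) / 2 * real n powr (- s) \<and>
        exp (- real r) / 2 < q n"
      by eventually_elim (auto simp: powr_minus_divide)
    then have "\<forall>\<^sub>F j in sequentially. \<omega> (m j) \<le> exp (- real r) / 2 * a j \<and>
        exp (- real r) / 2 < q (m j)"
      using eventually_compose_filterlim[OF _ filterlim_subseq[OF m(1)]] unfolding a_def by blast
    then obtain j where j: "\<omega> (m j) \<le> exp (- real r) / 2 * a j" "exp (- real r) / 2 < q (m j)"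
      using eventually_happens'[OF sequentially_bot] by blast
    have "0 < a j" using m_gt[of j] by (simp add: a_def)
    have "1 / real (m j) * real (m j - r) = 1 - real r / real (m j)"
      using m_gt[of j] by (simp add: of_nat_diff field_simps)
    then have "a j * q (m j) \<le> \<omega> (m j)"
      using \<omega>_ge[OF m_gt, of j j] by (simp only: q_def power_mult_distrib[symmetric])
    also have "\<dots> \<le> a j * (exp (- real r) / 2)" using j(1) by (simp add: mult.commute)
    finally show False using \<open>0 < a j\<close> j(2) by simp
  qed

  define N where "N j = (Suc (m j))\<^sup>2" for j
  have "strict_mono N"
    using m(1) unfolding N_def strict_mono_def by (simp add: power_strict_mono)
  then have N_at_top: "filterlim N sequentially sequentially" by (rule filterlim_subseq)
  have N_gt: "r < N j" for j
    using m_gt[of j] square_ge[of "m j"] by (simp add: N_def)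
  have \<alpha>_pos: "0 < \<alpha> (N j)" for j using assms(7) by (simp add: N_def)
  have w_le: "w (N j) \<le> \<omega> (N j)" for j
    using \<omega>_ge[OF N_gt, of 0 j] m(2) by (simp add: w_def a_def)
  have \<omega>_pos: "0 < \<omega> (N j)" for j using w_le[of j] w_pos[OF N_gt, of j] by simp
  have error_le: "approx_error (Phi (N j) \<sigma>) S \<le> ereal (\<alpha> (N j) * \<omega> (N j))" for j
  proof -
    have "approx_error (Phi (N j) \<sigma>) S \<le> ereal (\<Sum>i. a (i + Suc j))"
      unfolding N_def using assms(1-5) strict_mono_less_eq[OF m(1)]
      by (intro approx_error_S_le) auto
    also have "(\<Sum>i. a (i + Suc j)) \<le> 2 * a (Suc j)" by (rule tail)
    also have "\<dots> \<le> \<alpha> (N j) * w (N j)"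
      using below_\<epsilon>[of j] by (simp add: a_def \<epsilon>_def N_def)
    also have "\<dots> \<le> \<alpha> (N j) * \<omega> (N j)" using w_le \<alpha>_pos by (simp add: less_imp_le)
    finally show ?thesis by simp
  qed

  have limsup_pos: "limsup (\<lambda>n. ereal (\<omega> n) / approx_error (Phi n \<sigma>) S * ereal (\<alpha> n)) > 0"
  proof (rule ccontr)
    assume "\<not> ?thesis"
    then have "limsup (\<lambda>n. ereal (\<omega> n) / approx_error (Phi n \<sigma>) S * ereal (\<alpha> n)) < 1"
      by (simp only: not_less) (rule le_less_trans, assumption, simp)
    from Limsup_lessD[OF this]
    have "\<forall>\<^sub>F j in sequentially.
        ereal (\<omega> (N j)) / approx_error (Phi (N j) \<sigma>) S * ereal (\<alpha> (N j)) < 1"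
      by (rule eventually_compose_filterlim) (rule N_at_top)
    then obtain j where "ereal (\<omega> (N j)) / approx_error (Phi (N j) \<sigma>) S * ereal (\<alpha> (N j)) < 1"
      using eventually_happens'[OF sequentially_bot] by blast
    then show False
      using one_le_ereal_ratio[OF \<omega>_pos \<alpha>_pos approx_error_nonneg error_le, of j]
      by (simp add: not_less[symmetric])
  qed

  have not_small_error: "\<omega> \<notin> o(\<lambda>n. 1 / \<alpha> n * real_of_ereal (approx_error (Phi n \<sigma>) S))"
  proof
    assume "\<omega> \<in> o(\<lambda>n. 1 / \<alpha> n * real_of_ereal (approx_error (Phi n \<sigma>) S))"
    then have "\<forall>\<^sub>F n in sequentially.
        norm (\<omega> n) \<le> 1 / 2 * norm (1 / \<alpha> n * real_of_ereal (approx_error (Phi n \<sigma>) S))"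
      by (rule landau_o.smallD) simp
    then have "\<forall>\<^sub>F j in sequentially. norm (\<omega> (N j))
        \<le> 1 / 2 * norm (1 / \<alpha> (N j) * real_of_ereal (approx_error (Phi (N j) \<sigma>) S))"
      by (rule eventually_compose_filterlim) (rule N_at_top)
    then obtain j where j: "norm (\<omega> (N j))
        \<le> 1 / 2 * norm (1 / \<alpha> (N j) * real_of_ereal (approx_error (Phi (N j) \<sigma>) S))"
      using eventually_happens'[OF sequentially_bot] by blast
    obtain e where e: "approx_error (Phi (N j) \<sigma>) S = ereal e" "0 \<le> e" "e \<le> \<alpha> (N j) * \<omega> (N j)"
      using error_le[of j] approx_error_nonneg[of "Phi (N j) \<sigma>" S]
      by (cases "approx_error (Phi (N j) \<sigma>) S") auto
    then have "1 / \<alpha> (N j) * e \<le> \<omega> (N j)" using \<alpha>_pos[of j] by (simp add: field_simps)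
    moreover have "\<omega> (N j) \<le> 1 / 2 * (1 / \<alpha> (N j) * e)"
      using j e(1,2) \<omega>_pos[of j] \<alpha>_pos[of j] by simp
    ultimately show False using \<omega>_pos[of j] by linarith
  qed

  show ?thesis
    using continuous_on_S upper not_small limsup_pos not_small_error
    unfolding \<omega>_def s_def by (intro exI[of _ S] conjI exI[of _ "2 + 2 * 2 ^ r"]) auto
qed

end
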